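(* Let $\mathcal{C}=(C,d)$ be a finite chain complex of free abelian groups such that, for each $q$, the matrix of $d_q$ with respect to the bases $C_q$ and $C_{q-1}$ coincides with its Smith Normal Form (up to the ordering of the basis elements). Let $\rho$ be the least common multiple of all the non-zero entries of the matrices of $d_q$, over all $q$. Define $$H=\{x\in C : d(x)=0 \text{ and there is no } z\in C \text{ with } d(z)=\mu x \text{ for some integer } \mu>0\},$$ and define homomorphisms $f,g,\phi$ on generators as follows: - if $x\in C$ is such that $d(x)=\mu y$ for some integer $\mu>0$ and $y\in C$, then $f(x)=0$, $f(y)=0$, $\phi(x)=0$ and $\phi(y)=\frac{\rho}{\mu}\,x$; - if $x\in H$, then $f(x)=x$, $g(x)=\rho x$ and $\phi(x)=0$. Then $((C,d),H,f,g,\phi,\rho)$ is a $\rho$-AT-model for $\mathcal{C}$. Moreover, a prime $p$ divides $\rho$ if and only if $p$ takes part in the torsion subgroup of $H(\mathcal{C};\mathbf{Z})$, i.e. some invariant factor of some $H_q(\mathcal{C};\mathbf{Z})$ is a power of $p$.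
   Context: A finite chain complex $\mathcal{C}$ is a sequence of finitely generated free abelian groups $\mathcal{C}_q$ (zero for $q<0$ and for $q>n$) with differential $d_q:\mathcal{C}_q\to\mathcal{C}_{q-1}$, $d_qd_{q+1}=0$; it is encoded as $(C,d)$ with $C=\{C_q\}$, $C_q$ a finite basis of $\mathcal{C}_q$. That the matrices coincide with their Smith Normal Forms (up to ordering of basis elements) means: every row and every column of the matrix of $d_q$ has at most one non-zero entry, the non-zero entries are positive, and they can be ordered so that each divides the next. So every $x\in C$ satisfies either $d(x)=0$ or $d(x)=\mu y$ with $\mu>0$ and $y\in C$, and distinct $x$ of the second kind have distinct $y$. The least common multiple of an empty set is $1$. The torsion subgroup of $H_q(\mathcal{C};\mathbf{Z})$ is a direct sum of cyclic groups of prime power order $>1$; these uniquely determined prime powers are called the invariant factors of $H_q(\mathcal{C};\mathbf{Z})$. A $\lambda$-chain contraction ($\lambda\in\mathbf{Z}$, $\lambda\ne0$) of $(\mathcal{C},d)$ to $(\mathcal{C}',d')$ is a set $(f,g,\phi,\lambda)$ with $f:\mathcal{C}\to\mathcal{C}'$ and $g:\mathcal{C}'\to\mathcal{C}$ chain maps and $\phi=\{\phi_q:\mathcal{C}_q\to\mathcal{C}_{q+1}\}$ homomorphisms such that $fg=\lambda\, id_{\mathcal{C}'}$ and $\lambda\, id_{\mathcal{C}}-gf=\phi d+d\phi$. A $\lambda$-AT-model for $\mathcal{C}=(C,d)$ is a set $((C,d),H,f,g,\phi,\lambda)$ where $H=\{H_q\}$ is a graded set freely generating a chain complex $\mathcal{H}$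 with zero differential, and $(f,g,\phi,\lambda)$ is a $\lambda$-chain contraction of $\mathcal{C}$ to $\mathcal{H}$. *)

theory Defs
  imports "HOL-Algebra.Free_Abelian_Groups" "HOL-Algebra.Coset" "HOL-Number_Theory.Prime_Powers"
begin

text \<open>
  A finite chain complex is given by its finite bases \<open>C q\<close> (\<open>q\<close> an integer) and its differentials
  \<open>d q\<close>; the chain group in degree \<open>q\<close> is \<open>free_Abelian_group (C q)\<close>, whose generator for
  \<open>x \<in> C q\<close> is \<open>frag_of x\<close>. Graded maps are families indexed by the degree of their source. The
  values of all these maps outside the carriers of the chain groups are irrelevant.
\<close>

definition finite_chain_complex ::
    "(int \<Rightarrow> 'a set) \<Rightarrow> (int \<Rightarrow> ('a \<Rightarrow>\<^sub>0 int) \<Rightarrow> ('a \<Rightarrow>\<^sub>0 int)) \<Rightarrow> bool" where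
  "finite_chain_complex C d \<longleftrightarrow>
     (\<forall>q. finite (C q)) \<and>
     (\<exists>n. \<forall>q. q < 0 \<or> q > n \<longrightarrow> C q = {}) \<and>
     (\<forall>q. d q \<in> hom (free_Abelian_group (C q)) (free_Abelian_group (C (q - 1)))) \<and>
     (\<forall>q. \<forall>c \<in> carrier (free_Abelian_group (C (q + 1))). d q (d (q + 1) c) = 0)"

definition lambda_chain_contraction ::
    "(int \<Rightarrow> 'a set) \<Rightarrow> (int \<Rightarrow> ('a \<Rightarrow>\<^sub>0 int) \<Rightarrow> ('a \<Rightarrow>\<^sub>0 int)) \<Rightarrow>
     (int \<Rightarrow> 'b set) \<Rightarrow> (int \<Rightarrow> ('b \<Rightarrow>\<^sub>0 int) \<Rightarrow> ('b \<Rightarrow>\<^sub>0 int)) \<Rightarrow>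
     (int \<Rightarrow> ('a \<Rightarrow>\<^sub>0 int) \<Rightarrow> ('b \<Rightarrow>\<^sub>0 int)) \<Rightarrow>
     (int \<Rightarrow> ('b \<Rightarrow>\<^sub>0 int) \<Rightarrow> ('a \<Rightarrow>\<^sub>0 int)) \<Rightarrow>
     (int \<Rightarrow> ('a \<Rightarrow>\<^sub>0 int) \<Rightarrow> ('a \<Rightarrow>\<^sub>0 int)) \<Rightarrow> int \<Rightarrow> bool" where
  "lambda_chain_contraction C d C' d' f g \<phi> lam \<longleftrightarrow>
     finite_chain_complex C d \<and> finite_chain_complex C' d' \<and> lam \<noteq> 0 \<and>
     (\<forall>q. f q \<in> hom (free_Abelian_group (C q)) (free_Abelian_group (C' q))) \<and>
     (\<forall>q. \<forall>c \<in> carrier (free_Abelian_group (C q)). f (q - 1) (d q c) = d' q (f q c)) \<and>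
     (\<forall>q. g q \<in> hom (free_Abelian_group (C' q)) (free_Abelian_group (C q))) \<and>
     (\<forall>q. \<forall>c \<in> carrier (free_Abelian_group (C' q)). g (q - 1) (d' q c) = d q (g q c)) \<and>
     (\<forall>q. \<phi> q \<in> hom (free_Abelian_group (C q)) (free_Abelian_group (C (q + 1)))) \<and>
     (\<forall>q. \<forall>c \<in> carrier (free_Abelian_group (C' q)). f q (g q c) = frag_cmul lam c) \<and>
     (\<forall>q. \<forall>c \<in> carrier (free_Abelian_group (C q)).
        frag_cmul lam c - g q (f q c) = \<phi> (q - 1) (d q c) + d (q + 1) (\<phi> q c))"

definition lambda_AT_model ::
    "(int \<Rightarrow> 'a set) \<Rightarrow> (int \<Rightarrow> ('a \<Rightarrow>\<^sub>0 int) \<Rightarrow> ('a \<Rightarrow>\<^sub>0 int)) \<Rightarrow> (int \<Rightarrow> 'b set) \<Rightarrow>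
     (int \<Rightarrow> ('a \<Rightarrow>\<^sub>0 int) \<Rightarrow> ('b \<Rightarrow>\<^sub>0 int)) \<Rightarrow>
     (int \<Rightarrow> ('b \<Rightarrow>\<^sub>0 int) \<Rightarrow> ('a \<Rightarrow>\<^sub>0 int)) \<Rightarrow>
     (int \<Rightarrow> ('a \<Rightarrow>\<^sub>0 int) \<Rightarrow> ('a \<Rightarrow>\<^sub>0 int)) \<Rightarrow> int \<Rightarrow> bool" where
  "lambda_AT_model C d H f g \<phi> lam \<longleftrightarrow> lambda_chain_contraction C d H (\<lambda>q c. 0) f g \<phi> lam"

text \<open>The coefficient of \<open>y \<in> C (q - 1)\<close> in \<open>d q x\<close>, for \<open>x \<in> C q\<close>.\<close>

definition matrix_entry ::
    "(int \<Rightarrow> ('a \<Rightarrow>\<^sub>0 int) \<Rightarrow> ('a \<Rightarrow>\<^sub>0 int)) \<Rightarrow> int \<Rightarrow> 'a \<Rightarrow> 'a \<Rightarrow> int" where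
  "matrix_entry d q y x = Poly_Mapping.lookup (d q (frag_of x)) y"

text \<open>
  A matrix \<open>M\<close> with rows indexed by \<open>R\<close> and columns indexed by \<open>S\<close> that is its own Smith normal form
  up to the ordering of rows and columns. The list \<open>ps\<close> enumerates the positions of the non-zero
  entries, so that equal entries in different positions are all accounted for.
\<close>

definition smith_normal_form :: "'a set \<Rightarrow> 'b set \<Rightarrow> ('a \<Rightarrow> 'b \<Rightarrow> int) \<Rightarrow> bool" where
  "smith_normal_form R S M \<longleftrightarrow>
     (\<forall>y\<in>R. \<forall>x\<in>S. \<forall>x'\<in>S. M y x \<noteq> 0 \<and> M y x' \<noteq> 0 \<longrightarrow> x = x') \<and>
     (\<forall>x\<in>S. \<forall>y\<in>R. \<forall>y'\<in>R. M y x \<noteq> 0 \<and> M y' x \<noteq> 0 \<longrightarrow> y = y') \<and>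
     (\<forall>y\<in>R. \<forall>x\<in>S. M y x \<noteq> 0 \<longrightarrow> M y x > 0) \<and>
     (\<exists>ps. distinct ps \<and> set ps = {(y, x). y \<in> R \<and> x \<in> S \<and> M y x \<noteq> 0} \<and>
           successively (dvd) (map (\<lambda>(y, x). M y x) ps))"

definition entries_lcm ::
    "(int \<Rightarrow> 'a set) \<Rightarrow> (int \<Rightarrow> ('a \<Rightarrow>\<^sub>0 int) \<Rightarrow> ('a \<Rightarrow>\<^sub>0 int)) \<Rightarrow> int" where
  "entries_lcm C d =
     Lcm {matrix_entry d q y x | q y x. y \<in> C (q - 1) \<and> x \<in> C q \<and> matrix_entry d q y x \<noteq> 0}"

definition homology_basis ::
    "(int \<Rightarrow> 'a set) \<Rightarrow> (int \<Rightarrow> ('a \<Rightarrow>\<^sub>0 int) \<Rightarrow> ('a \<Rightarrow>\<^sub>0 int)) \<Rightarrow> int \<Rightarrow> 'a set" where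
  "homology_basis C d q =
     {x \<in> C q. d q (frag_of x) = 0 \<and>
        \<not> (\<exists>z \<in> C (q + 1). \<exists>\<mu>>0. d (q + 1) (frag_of z) = frag_cmul \<mu> (frag_of x))}"

text \<open>
  The homomorphisms \<open>f\<close>, \<open>g\<close>, \<open>\<phi>\<close> prescribed on generators. The division \<open>\<rho> div \<mu>\<close> is exact for
  \<open>\<rho> = entries_lcm C d\<close>.
\<close>

definition prescribed_maps ::
    "(int \<Rightarrow> 'a set) \<Rightarrow> (int \<Rightarrow> ('a \<Rightarrow>\<^sub>0 int) \<Rightarrow> ('a \<Rightarrow>\<^sub>0 int)) \<Rightarrow> (int \<Rightarrow> 'a set) \<Rightarrow> int \<Rightarrow>
     (int \<Rightarrow> ('a \<Rightarrow>\<^sub>0 int) \<Rightarrow> ('a \<Rightarrow>\<^sub>0 int)) \<Rightarrow>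
     (int \<Rightarrow> ('a \<Rightarrow>\<^sub>0 int) \<Rightarrow> ('a \<Rightarrow>\<^sub>0 int)) \<Rightarrow>
     (int \<Rightarrow> ('a \<Rightarrow>\<^sub>0 int) \<Rightarrow> ('a \<Rightarrow>\<^sub>0 int)) \<Rightarrow> bool" where
  "prescribed_maps C d H \<rho> f g \<phi> \<longleftrightarrow>
     (\<forall>q. f q \<in> hom (free_Abelian_group (C q)) (free_Abelian_group (H q))) \<and>
     (\<forall>q. g q \<in> hom (free_Abelian_group (H q)) (free_Abelian_group (C q))) \<and>
     (\<forall>q. \<phi> q \<in> hom (free_Abelian_group (C q)) (free_Abelian_group (C (q + 1)))) \<and>
     (\<forall>q. \<forall>x \<in> C q. \<forall>y \<in> C (q - 1). \<forall>\<mu>>0. d q (frag_of x) = frag_cmul \<mu> (frag_of y) \<longrightarrow>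
        f q (frag_of x) = 0 \<and> f (q - 1) (frag_of y) = 0 \<and>
        \<phi> q (frag_of x) = 0 \<and> \<phi> (q - 1) (frag_of y) = frag_cmul (\<rho> div \<mu>) (frag_of x)) \<and>
     (\<forall>q. \<forall>x \<in> H q.
        f q (frag_of x) = frag_of x \<and> g q (frag_of x) = frag_cmul \<rho> (frag_of x) \<and>
        \<phi> q (frag_of x) = 0)"

definition homology ::
    "(int \<Rightarrow> 'a set) \<Rightarrow> (int \<Rightarrow> ('a \<Rightarrow>\<^sub>0 int) \<Rightarrow> ('a \<Rightarrow>\<^sub>0 int)) \<Rightarrow> int \<Rightarrow> ('a \<Rightarrow>\<^sub>0 int) set monoid" where
  "homology C d q =
     (free_Abelian_group (C q))
       \<lparr>carrier := kernel (free_Abelian_group (C q)) (free_Abelian_group (C (q - 1))) (d q)\<rparr>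
     Mod (d (q + 1) ` carrier (free_Abelian_group (C (q + 1))))"

definition torsion_subgroup :: "('a, 'b) monoid_scheme \<Rightarrow> ('a, 'b) monoid_scheme" where
  "torsion_subgroup G =
     G\<lparr>carrier := {x \<in> carrier G. \<exists>n::nat. n > 0 \<and> x [^]\<^bsub>G\<^esub> n = \<one>\<^bsub>G\<^esub>}\<rparr>"

text \<open>
  The list \<open>ms\<close> is determined by \<open>G\<close> up to permutation, so it is immaterial which decomposition of
  the torsion subgroup is taken.
\<close>

definition invariant_factor :: "('a, 'b) monoid_scheme \<Rightarrow> nat \<Rightarrow> bool" where
  "invariant_factor G m \<longleftrightarrow>
     (\<exists>ms. m \<in> set ms \<and> (\<forall>k \<in> set ms. primepow k) \<and>
           torsion_subgroup G \<cong> sum_group {..<length ms} (\<lambda>i. integer_mod_group (ms ! i)))"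

end

theory Submission
  imports Defs "HOL-Number_Theory.Cong"
begin

text \<open>
  In degree \<open>q\<close> the boundaries are the combinations of the targets \<open>y\<close> of arrows \<open>d(x) = \<mu> y\<close> in which
  every coefficient is divisible by the corresponding \<open>\<mu>\<close>, and a cycle is torsion modulo boundaries
  iff only such \<open>y\<close> occur in it. So the torsion subgroup of the homology is the sum of the cyclic
  groups of order \<open>\<mu>\<close>. The Chinese remainder theorem splits it into primary parts, which gives an
  invariant factor for each prime dividing some \<open>\<mu>\<close>; conversely, \<open>\<rho>\<close> annihilates the torsion, hence
  is a multiple of every invariant factor. The contraction identities are checked on the three
  kinds of generators: sources of arrows, targets of arrows, and elements of \<open>H\<close>.
\<close>

section \<open>Homomorphisms of free abelian groups\<close>

text \<open>Both sides respect differences and agree on generators. The support condition on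
  \<open>c\<close> is essential, since a homomorphism is unconstrained off its carrier. The value at
  zero comes from the difference rule applied to \<open>0 - 0\<close>.\<close>

lemma hom_eq_frag_extend:
  assumes "h \<in> hom (free_Abelian_group S) (free_Abelian_group T)" "Poly_Mapping.keys c \<subseteq> S"
  shows "h c = frag_extend (\<lambda>x. h (frag_of x)) c"
  using assms(2)
  by (rule free_Abelian_group_induct)
     (use hom_frag_diff[OF assms(1), of 0 0] in
       \<open>auto simp: hom_frag_diff[OF assms(1)] frag_extend_diff\<close>)

lemma hom_frag_cmul:
  assumes "h \<in> hom (free_Abelian_group S) (free_Abelian_group T)" "Poly_Mapping.keys c \<subseteq> S"
  shows "h (frag_cmul k c) = frag_cmul k (h c)"
  using assms keys_cmul[of k c]
  by (subst (1 2) hom_eq_frag_extend[OF assms(1)]) (auto simp: frag_extend_cmul)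

lemma hom_frag_zero:
  assumes "h \<in> hom (free_Abelian_group S) (free_Abelian_group T)"
  shows "h 0 = 0"
  using hom_eq_frag_extend[OF assms, of 0] by simp

lemma frag_cmul_diff_distrib2: "frag_cmul k (a - b) = frag_cmul k a - frag_cmul k b"
  by (rule poly_mapping_eqI) (simp add: lookup_minus algebra_simps)

lemma frag_extend_in_hom:
  assumes "\<And>x. x \<in> S \<Longrightarrow> Poly_Mapping.keys (F x) \<subseteq> T"
  shows "frag_extend F \<in> hom (free_Abelian_group S) (free_Abelian_group T)"
proof (rule homI)
  fix c assume "c \<in> carrier (free_Abelian_group S)"
  then show "frag_extend F c \<in> carrier (free_Abelian_group T)"
    using keys_frag_extend[of F c] assms by fastforce
qed (simp add: frag_extend_add)

lemma lookup_sum_frag_cmul: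
  assumes "finite Y" "y \<in> Y"
  shows "Poly_Mapping.lookup (\<Sum>x\<in>Y. frag_cmul (a x) (frag_of x)) y = a y"
  using assms by (simp add: lookup_sum if_distrib[of "\<lambda>t. _ * t"] sum.delta cong: if_cong)

section \<open>Torsion of quotients\<close>

text \<open>A coset of \<open>x\<close> has finite order iff some positive power of \<open>x\<close>
  lies in \<open>N\<close>. Cosets and their products do not depend on the carrier, so this is an
  equality of groups and not merely an isomorphism.\<close>

lemma torsion_subgroup_Mod:
  fixes G :: "('a, 'b) monoid_scheme" (structure)
  assumes "N \<lhd> G"
  shows "torsion_subgroup (G Mod N) =
    G\<lparr>carrier := {x \<in> carrier G. \<exists>n::nat. n > 0 \<and> x [^]\<^bsub>G\<^esub> n \<in> N}\<rparr> Mod N"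
proof -
  interpret normal N G by fact
  have coset: "r_coset (G\<lparr>carrier := X\<rparr>) N x = r_coset G N x" for X x
    by (simp add: r_coset_def)
  have mult: "set_mult (G\<lparr>carrier := X\<rparr>) = set_mult G" for X
    by (simp add: set_mult_def fun_eq_iff)
  have "N #> (x [^] n) = N \<longleftrightarrow> x [^] n \<in> N" if "x \<in> carrier G" for x and n :: nat
    using that by (metis coset_join1 coset_join2 nat_pow_closed is_subgroup subset)
  then have "{X \<in> carrier (G Mod N). \<exists>n::nat. n > 0 \<and> X [^]\<^bsub>G Mod N\<^esub> n = \<one>\<^bsub>G Mod N\<^esub>} =
    (\<lambda>x. N #> x) ` {x \<in> carrier G. \<exists>n::nat. n > 0 \<and> x [^] n \<in> N}"
    by (auto simp: carrier_FactGroup FactGroup_pow intro!: imageI)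
  then show ?thesis
    by (simp add: torsion_subgroup_def)
       (auto simp: FactGroup_def RCOSETS_def coset mult)
qed

text \<open>An exponent of the whole group annihilates the generator of the summand of order
  \<open>m\<close>, and therefore is a multiple of \<open>m\<close>.\<close>

lemma dvd_exponent_sum_group:
  assumes "group G"
    and iso: "G \<cong> sum_group {..<length ms} (\<lambda>i. integer_mod_group (ms ! i))"
    and exponent: "\<And>x. x \<in> carrier G \<Longrightarrow> x [^]\<^bsub>G\<^esub> n = \<one>\<^bsub>G\<^esub>"
    and "m \<in> set ms" "m \<noteq> 1"
  shows "m dvd n"
proof -
  interpret G: group G by fact
  let ?S = "sum_group {..<length ms} (\<lambda>i. integer_mod_group (ms ! i))"
  obtain i where i: "i < length ms" "ms ! i = m"
    using \<open>m \<in> set ms\<close> by (auto simp: in_set_conv_nth)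
  obtain h where h: "h \<in> Group.iso G ?S"
    using iso by (auto simp: is_iso_def)
  \<comment> \<open>The generator of summand \<open>i\<close>, zero elsewhere. Since
    \<open>m\<close> is not 1, the integer 1 is a legitimate representative in that summand.\<close>
  let ?u = "\<lambda>j\<in>{..<length ms}. if j = i then 1 else (0::int)"
  have "?u \<in> carrier ?S"
    using i \<open>m \<noteq> 1\<close> by (auto simp: carrier_sum_group)
  moreover have "h ` carrier G = carrier ?S"
    using h by (simp add: iso_def bij_betw_def)
  ultimately obtain x where x: "x \<in> carrier G" "h x = ?u"
    by (metis imageE)
  have "(\<lambda>t. h t i) \<in> hom G (integer_mod_group m)"
    using h i by (auto simp: iso_def hom_def carrier_sum_group Pi_iff)
  then have "h (x [^]\<^bsub>G\<^esub> n) i = h x i [^]\<^bsub>integer_mod_group m\<^esub> n"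
    and "h \<one>\<^bsub>G\<^esub> i = 0"
    using x by (simp_all add: hom_nat_pow[of "\<lambda>t. h t i"] hom_one[of "\<lambda>t. h t i"] G.group_axioms)
  then have "int n mod int m = 0"
    using x i exponent by simp
  then show ?thesis
    by (metis int_dvd_int_iff dvd_eq_mod_eq_0)
qed

text \<open>Multiplicities are compared prime by prime; \<open>k = 0\<close> is split off because
  the comparison only decides divisibility of non-zero numbers.\<close>

lemma dvd_if_primary_parts_dvd:
  fixes n k :: nat
  assumes "n > 0" "\<And>p. p \<in> prime_factors n \<Longrightarrow> p ^ multiplicity p n dvd k"
  shows "n dvd k"
proof (cases "k = 0")
  case False
  show ?thesis
  proof (rule multiplicity_le_imp_dvd)
    fix p :: nat assume "prime p"
    show "multiplicity p n \<le> multiplicity p k"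
    proof (cases "p dvd n")
      case True
      then show ?thesis
        using assms \<open>prime p\<close> False
        by (intro multiplicity_geI) (auto simp: prime_factors_dvd)
    qed (simp add: not_dvd_imp_multiplicity_0)
  qed (use assms in auto)
qed simp

section \<open>Quotients of free abelian groups by diagonal sublattices\<close>

text \<open>This is the span of the multiples \<open>m y\<close> of the generators \<open>y\<close>.
  Describing it by coefficients turns membership into divisibility conditions.\<close>

definition diagonal_sublattice :: "'a set \<Rightarrow> ('a \<Rightarrow> nat) \<Rightarrow> ('a \<Rightarrow>\<^sub>0 int) set" where
  "diagonal_sublattice Y m =
     {c. Poly_Mapping.keys c \<subseteq> Y \<and> (\<forall>y\<in>Y. int (m y) dvd Poly_Mapping.lookup c y)}"

lemma diagonal_sublattice_subgroup:
  assumes "Y \<subseteq> S"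
  shows "subgroup (diagonal_sublattice Y m) (free_Abelian_group S)"
proof -
  interpret group "free_Abelian_group S"
    by simp
  have keys: "Poly_Mapping.keys c \<subseteq> S" if "c \<in> diagonal_sublattice Y m" for c
    using that assms by (auto simp: diagonal_sublattice_def)
  show ?thesis
  proof (rule subgroupI)
    show "diagonal_sublattice Y m \<noteq> {}"
      by (auto simp: diagonal_sublattice_def intro!: exI[of _ 0])
  qed (auto simp: keys, auto simp: diagonal_sublattice_def lookup_add dest: subsetD[OF keys_add])
qed

lemma diagonal_sublattice_normal: "diagonal_sublattice Y m \<lhd> free_Abelian_group Y"
  by (intro comm_group.subgroup_imp_normal abelian_free_Abelian_group diagonal_sublattice_subgroup) simp

text \<open>Reducing the coefficient of each \<open>y\<close> modulo every primary part of
  \<open>m y\<close> is a surjection with kernel the sublattice, so the first isomorphism theorem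
  applies. A generator with \<open>m y = 1\<close> contributes no summand.\<close>

lemma free_Abelian_group_Mod_diagonal:
  fixes Y :: "'a set" and m :: "'a \<Rightarrow> nat"
  assumes Y: "finite Y" and m: "\<And>y. y \<in> Y \<Longrightarrow> m y > 0"
  obtains ms where "\<And>k. k \<in> set ms \<Longrightarrow> primepow k"
    and "\<And>y p. y \<in> Y \<Longrightarrow> prime p \<Longrightarrow> p dvd m y \<Longrightarrow> \<exists>k. p ^ k \<in> set ms"
    and "free_Abelian_group Y Mod diagonal_sublattice Y m \<cong>
           sum_group {..<length ms} (\<lambda>i. integer_mod_group (ms ! i))"
proof -
  have "finite (SIGMA y:Y. prime_factors (m y))"
    using Y by simp
  \<comment> \<open>The summands are indexed by pairs of a generator and a prime, not by their
    orders, so summands of equal order stay separate.\<close>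
  then obtain ps where ps: "set ps = (SIGMA y:Y. prime_factors (m y))" "distinct ps"
    using finite_distinct_list by blast
  define part where "part = (\<lambda>(y, p). p ^ multiplicity p (m y))"
  define ms where "ms = map part ps"
  have len: "length ms = length ps"
    by (simp add: ms_def)
  let ?S = "sum_group {..<length ms} (\<lambda>i. integer_mod_group (ms ! i))"
  let ?F = "free_Abelian_group Y"
  have ps_nth: "fst (ps ! i) \<in> Y" "snd (ps ! i) \<in> prime_factors (m (fst (ps ! i)))"
      "ms ! i = snd (ps ! i) ^ multiplicity (snd (ps ! i)) (m (fst (ps ! i)))" if "i < length ps" for i
    using nth_mem[OF that] ps(1) that by (auto simp: ms_def part_def split: prod.splits)
  have ms_pos: "ms ! i > 0" if "i < length ps" for i
    using ps_nth[OF that] by (auto simp: prime_gt_0_nat dest: in_prime_factors_imp_prime)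
  have primepow: "primepow k" if "k \<in> set ms" for k
    using that m unfolding ms_def set_map ps(1)
    by (auto simp: part_def prime_factors_dvd prime_multiplicity_gt_zero_iff
             intro!: primepow_prime_power)
  have divisor: "\<exists>k. p ^ k \<in> set ms" if "y \<in> Y" "prime p" "p dvd m y" for y p
  proof
    have "(y, p) \<in> set ps"
      using that m ps(1) by (auto simp: prime_factors_dvd)
    then show "p ^ multiplicity p (m y) \<in> set ms"
      by (force simp: ms_def part_def)
  qed
  define h where "h = (\<lambda>c. \<lambda>i\<in>{..<length ms}. Poly_Mapping.lookup c (fst (ps ! i)) mod int (ms ! i))"
  have h_hom: "h \<in> hom ?F ?S"
    using ms_pos
    by (intro homI) (auto simp: h_def carrier_sum_group carrier_integer_mod_group len lookup_add
        mod_add_eq fun_eq_iff)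
  interpret group_hom ?F ?S h
    using h_hom by (simp add: group_hom_def group_hom_axioms_def)
  \<comment> \<open>A coefficient is divisible by \<open>m y\<close> iff it is divisible by all
    primary parts of \<open>m y\<close>.\<close>
  have "kernel ?F ?S h = diagonal_sublattice Y m"
  proof -
    have "(\<forall>i<length ps. int (ms ! i) dvd Poly_Mapping.lookup c (fst (ps ! i))) \<longleftrightarrow>
          (\<forall>y\<in>Y. int (m y) dvd Poly_Mapping.lookup c y)" (is "?L \<longleftrightarrow> ?R") for c
    proof
      assume L: ?L
      show ?R
      proof
        fix y assume y: "y \<in> Y"
        have "p ^ multiplicity p (m y) dvd nat \<bar>Poly_Mapping.lookup c y\<bar>"
          if p: "p \<in> prime_factors (m y)" for p
        proof -
          have "(y, p) \<in> set ps"
            using ps(1) y p by auto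
          then obtain i where i: "i < length ps" "ps ! i = (y, p)"
            by (auto simp: in_set_conv_nth)
          then have "int (part (y, p)) dvd Poly_Mapping.lookup c y"
            using L[rule_format, of i] ps_nth(3)[of i] by (simp add: part_def)
          then show ?thesis
            by (simp add: part_def nat_abs_dvd_iff flip: int_dvd_int_iff of_nat_power)
        qed
        then have "m y dvd nat \<bar>Poly_Mapping.lookup c y\<bar>"
          using m[OF y] dvd_if_primary_parts_dvd by blast
        then show "int (m y) dvd Poly_Mapping.lookup c y"
          by (simp flip: int_dvd_int_iff)
      qed
    next
      assume R: ?R
      show ?L
      proof (intro allI impI)
        fix i assume i: "i < length ps"
        have "ms ! i dvd m (fst (ps ! i))"
          using ps_nth(3)[OF i] by (simp add: multiplicity_dvd)
        then show "int (ms ! i) dvd Poly_Mapping.lookup c (fst (ps ! i))"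
          using R ps_nth(1)[OF i] by (meson dvd_trans int_dvd_int_iff)
      qed
    qed
    then show ?thesis
      by (auto simp: kernel_def diagonal_sublattice_def h_def len fun_eq_iff restrict_def
          dvd_eq_mod_eq_0)
  qed
  moreover have "h ` carrier ?F = carrier ?S"
  proof
    show "h ` carrier ?F \<subseteq> carrier ?S"
      using h_hom by (auto simp: hom_def)
    show "carrier ?S \<subseteq> h ` carrier ?F"
    proof
      fix t assume t: "t \<in> carrier ?S"
      \<comment> \<open>Surjectivity is solved for each \<open>y\<close> separately: positions over
        the same \<open>y\<close> carry different primes, so their moduli are pairwise
        coprime.\<close>
      have "\<exists>a::nat. \<forall>i\<in>{i. i < length ps \<and> fst (ps ! i) = y}. [a = nat (t i)] (mod (ms ! i))" for y
      proof (rule chinese_remainder_nat; safe?)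
        fix i j assume ij: "i < length ps" "j < length ps" "fst (ps ! j) = fst (ps ! i)" "i \<noteq> j"
        then have "snd (ps ! i) \<noteq> snd (ps ! j)"
          using ps(2) by (metis nth_eq_iff_index_eq prod_eqI)
        then have "coprime (snd (ps ! i)) (snd (ps ! j))"
          using ij ps_nth(2)[of i] ps_nth(2)[of j] by (auto intro: primes_coprime)
        then show "coprime (ms ! i) (ms ! j)"
          using ij by (simp add: ps_nth(3))
      qed auto
      then obtain a :: "'a \<Rightarrow> nat" where
        a: "\<And>i. i < length ps \<Longrightarrow> [a (fst (ps ! i)) = nat (t i)] (mod (ms ! i))"
        by simp metis
      define c where "c = (\<Sum>x\<in>Y. frag_cmul (int (a x)) (frag_of x))"
      have c: "Poly_Mapping.lookup c y = int (a y)" if "y \<in> Y" for y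
        unfolding c_def by (rule lookup_sum_frag_cmul[OF Y that])
      have "c \<in> carrier ?F"
        unfolding c_def by (rule sum_closed_free_Abelian_group) auto
      moreover have "h c = t"
      proof
        fix i
        show "h c i = t i"
        proof (cases "i < length ps")
          case True
          \<comment> \<open>The entry \<open>t i\<close> is a reduced residue: \<open>nat\<close>
            does not alter it, and reducing \<open>a\<close> modulo \<open>ms ! i\<close> gives back
            exactly \<open>t i\<close>.\<close>
          then have "0 \<le> t i" "t i < int (ms ! i)"
            using t ms_pos[OF True]
            by (auto simp: carrier_sum_group carrier_integer_mod_group len PiE_def Pi_def split: if_splits)
          moreover have "[int (a (fst (ps ! i))) = int (nat (t i))] (mod int (ms ! i))"
            using a[OF True] by (simp only: cong_int_iff)
          ultimately show ?thesis
            using True by (simp add: h_def len c ps_nth cong_def)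
        next
          case False
          then show ?thesis
            using t by (auto simp: h_def len carrier_sum_group PiE_def extensional_def)
        qed
      qed
      ultimately show "t \<in> h ` carrier ?F"
        by blast
    qed
  qed
  ultimately have "?F Mod diagonal_sublattice Y m \<cong> ?S"
    using FactGroup_iso by simp
  then show ?thesis
    using that primepow divisor by blast
qed

section \<open>Complexes in Smith normal form\<close>

locale smith_complex =
  fixes C :: "int \<Rightarrow> 'a set"
    and d :: "int \<Rightarrow> ('a \<Rightarrow>\<^sub>0 int) \<Rightarrow> ('a \<Rightarrow>\<^sub>0 int)"
  assumes complex: "finite_chain_complex C d"
    and snf: "\<And>q. smith_normal_form (C (q - 1)) (C q) (matrix_entry d q)"
begin

text \<open>The index \<open>q\<close> is the degree of the target, so arrows leaving degree
  \<open>q\<close> have index \<open>q - 1\<close>. The row and column conditions make the arrows a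
  partial matching between adjacent bases.\<close>

definition arrow :: "int \<Rightarrow> 'a \<Rightarrow> 'a \<Rightarrow> int \<Rightarrow> bool" where
  "arrow q z x \<mu> \<longleftrightarrow> z \<in> C (q + 1) \<and> x \<in> C q \<and> \<mu> > 0 \<and>
     d (q + 1) (frag_of z) = frag_cmul \<mu> (frag_of x)"

abbreviation "\<rho> \<equiv> entries_lcm C d"

abbreviation "H \<equiv> homology_basis C d"

lemma finite_basis: "finite (C q)"
  using complex by (simp add: finite_chain_complex_def)

lemma d_hom: "d q \<in> hom (free_Abelian_group (C q)) (free_Abelian_group (C (q - 1)))"
  using complex by (simp add: finite_chain_complex_def)

lemma d_d: "Poly_Mapping.keys c \<subseteq> C (q + 1) \<Longrightarrow> d q (d (q + 1) c) = 0"
  using complex by (simp add: finite_chain_complex_def)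

lemma arrow_entry: "arrow q z x \<mu> \<Longrightarrow> matrix_entry d (q + 1) x z = \<mu>"
  by (simp add: arrow_def matrix_entry_def)

text \<open>The row of \<open>x\<close> has at most one non-zero entry, and that entry is the weight
  of the arrow.\<close>

lemma arrow_source_unique:
  assumes "arrow q z x \<mu>" "arrow q z' x \<nu>"
  shows "z' = z" "\<nu> = \<mu>"
proof -
  show "z' = z"
    using assms snf[of "q + 1"] arrow_entry[OF assms(1)] arrow_entry[OF assms(2)]
    unfolding smith_normal_form_def arrow_def by fastforce
  then show "\<nu> = \<mu>"
    using arrow_entry[OF assms(1)] arrow_entry[OF assms(2)] by simp
qed

text \<open>If the boundary of \<open>z\<close> is not zero, pick a generator occurring in it. The
  column of \<open>z\<close> has no other non-zero entry, so the boundary is a multiple of that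
  generator, with positive coefficient.\<close>

lemma d_generator_cases:
  assumes z: "z \<in> C q"
  obtains "d q (frag_of z) = 0" | x \<mu> where "arrow (q - 1) z x \<mu>"
proof (cases "d q (frag_of z) = 0")
  case False
  then obtain x where x: "x \<in> Poly_Mapping.keys (d q (frag_of z))"
    by fastforce
  have keys: "Poly_Mapping.keys (d q (frag_of z)) \<subseteq> C (q - 1)"
    using hom_in_carrier[OF d_hom, of "frag_of z" q] z by simp
  let ?\<mu> = "matrix_entry d q x z"
  have "?\<mu> \<noteq> 0"
    using x by (simp add: matrix_entry_def in_keys_iff)
  then have "?\<mu> > 0"
    using snf[of q] z x keys unfolding smith_normal_form_def by blast
  moreover have "d q (frag_of z) = frag_cmul ?\<mu> (frag_of x)"
  proof (rule poly_mapping_eqI)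
    fix x'
    show "Poly_Mapping.lookup (d q (frag_of z)) x' =
        Poly_Mapping.lookup (frag_cmul ?\<mu> (frag_of x)) x'"
    proof (cases "x' \<in> Poly_Mapping.keys (d q (frag_of z))")
      case True
      then have "matrix_entry d q x' z \<noteq> 0"
        by (simp add: matrix_entry_def in_keys_iff)
      then have "x' = x"
        using snf[of q] z x True keys \<open>?\<mu> \<noteq> 0\<close> unfolding smith_normal_form_def by blast
      then show ?thesis
        by (simp add: matrix_entry_def)
    next
      case False
      then show ?thesis
        using x by (auto simp: in_keys_iff)
    qed
  qed
  ultimately show ?thesis
    using that(2)[of x ?\<mu>] z x keys by (auto simp: arrow_def)
qed (use that in blast)

text \<open>From d d = 0 one gets that \<mu> times the boundary of \<open>x\<close> vanishes, and a
  free abelian group has no torsion.\<close>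

lemma d_target:
  assumes "arrow q z x \<mu>"
  shows "d q (frag_of x) = 0"
proof -
  have "d q (frag_cmul \<mu> (frag_of x)) = 0"
    using assms d_d[of "frag_of z" q] by (simp add: arrow_def)
  then show ?thesis
    using assms hom_frag_cmul[OF d_hom, of "frag_of x" q \<mu>] by (simp add: arrow_def)
qed

lemma homology_basis_iff:
  "x \<in> H q \<longleftrightarrow> x \<in> C q \<and> d q (frag_of x) = 0 \<and> (\<nexists>z \<mu>. arrow q z x \<mu>)"
  by (auto simp: homology_basis_def arrow_def)

text \<open>A generator with non-zero boundary is a source; one with zero boundary is a target or,
  failing that, belongs to \<open>H\<close> by definition.\<close>

lemma generator_cases:
  assumes "x \<in> C q"
  obtains y \<mu> where "arrow (q - 1) x y \<mu>" | z \<mu> where "arrow q z x \<mu>" | "x \<in> H q"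
  using assms by (metis d_generator_cases homology_basis_iff)

section \<open>The least common multiple of the entries\<close>

lemma entries_lcm_eq: "\<rho> = Lcm {\<mu>. \<exists>q z x. arrow q z x \<mu>}"
proof -
  have "{matrix_entry d q y x | q y x. y \<in> C (q - 1) \<and> x \<in> C q \<and> matrix_entry d q y x \<noteq> 0} =
        {\<mu>. \<exists>q z x. arrow q z x \<mu>}" (is "?L = ?R")
  proof (intro equalityI subsetI)
    fix \<mu> assume "\<mu> \<in> ?L"
    then obtain q y x where *: "y \<in> C (q - 1)" "x \<in> C q" "\<mu> = matrix_entry d q y x" "\<mu> \<noteq> 0"
      by auto
    show "\<mu> \<in> ?R"
      using *(2)
    proof (cases rule: d_generator_cases)
      case 1
      then show ?thesis
        using * by (simp add: matrix_entry_def)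
    next
      case (2 y' \<mu>')
      then have "\<mu> = \<mu>'"
        using * by (auto simp: matrix_entry_def arrow_def split: if_splits)
      then show ?thesis
        using 2 by blast
    qed
  next
    fix \<mu> assume "\<mu> \<in> ?R"
    then obtain q z x where a: "arrow q z x \<mu>"
      by blast
    then have "\<mu> = matrix_entry d (q + 1) x z"
      using arrow_entry by simp
    moreover have "x \<in> C (q + 1 - 1)" "z \<in> C (q + 1)" "\<mu> \<noteq> 0"
      using a by (auto simp: arrow_def)
    ultimately show "\<mu> \<in> ?L"
      by blast
  qed
  then show ?thesis
    by (simp add: entries_lcm_def)
qed

text \<open>Only finitely many degrees have a non-empty basis, and each basis is finite. This keeps
  \<rho> non-zero, because \<open>Lcm\<close> of an infinite set of integers is 0.\<close>

lemma finite_weights: "finite {\<mu>. \<exists>q z x. arrow q z x \<mu>}"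
proof -
  obtain n where n: "\<And>q. q < 0 \<or> q > n \<Longrightarrow> C q = {}"
    using complex by (auto simp: finite_chain_complex_def)
  have "{\<mu>. \<exists>q z x. arrow q z x \<mu>} \<subseteq>
    (\<Union>q\<in>{0..n}. (\<lambda>(x, z). matrix_entry d (q + 1) x z) ` (C q \<times> C (q + 1)))"
  proof clarify
    fix \<mu> q z x assume a: "arrow q z x \<mu>"
    then have "q \<in> {0..n}"
      using n[of q] by (fastforce simp: arrow_def)
    then show "\<mu> \<in> (\<Union>q\<in>{0..n}. (\<lambda>(x, z). matrix_entry d (q + 1) x z) ` (C q \<times> C (q + 1)))"
      using a arrow_entry[OF a] by (force simp: arrow_def)
  qed
  then show ?thesis
    by (rule finite_subset) (simp add: finite_basis)
qed

lemma entries_lcm_pos: "\<rho> > 0"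
proof -
  have "\<rho> \<noteq> 0"
    using finite_weights by (auto simp: entries_lcm_eq Lcm_0_iff arrow_def)
  moreover have "\<rho> \<ge> 0"
    unfolding entries_lcm_def by (rule Lcm_int_greater_eq_0)
  ultimately show ?thesis
    by linarith
qed

lemma arrow_dvd_entries_lcm: "arrow q z x \<mu> \<Longrightarrow> \<mu> dvd \<rho>"
  unfolding entries_lcm_eq by (rule dvd_Lcm) blast

text \<open>By induction over the finite set of weights: the lcm of two numbers divides their
  product, so a prime dividing it divides one of them. For the empty set the lcm is 1, which no
  prime divides.\<close>

lemma prime_dvd_entries_lcmE:
  assumes "prime (p::int)" "p dvd \<rho>"
  obtains q z x \<mu> where "arrow q z x \<mu>" "p dvd \<mu>"
proof -
  have "finite M \<Longrightarrow> p dvd Lcm M \<Longrightarrow> \<exists>\<mu>\<in>M. p dvd \<mu>" for M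
  proof (induction M rule: finite_induct)
    case empty
    then show ?case
      using assms(1) by (simp add: not_prime_unit)
  next
    case (insert \<mu> M)
    have "lcm \<mu> (Lcm M) dvd \<mu> * Lcm M"
      by (simp add: lcm_least)
    then have "p dvd \<mu> * Lcm M"
      using insert.prems by (metis Lcm_insert dvd_trans)
    then show ?case
      using assms(1) insert.IH prime_dvd_mult_iff by auto
  qed
  then show ?thesis
    using that assms(2) finite_weights unfolding entries_lcm_eq by blast
qed

subsection \<open>The contraction\<close>

text \<open>Restates the prescriptions in terms of arrows, moving the index from the source degree
  to the target degree.\<close>

lemma prescribed_mapsD:
  assumes "prescribed_maps C d H \<rho> f g \<phi>"
  shows "f q \<in> hom (free_Abelian_group (C q)) (free_Abelian_group (H q))"
    and "g q \<in> hom (free_Abelian_group (H q)) (free_Abelian_group (C q))"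
    and "\<phi> q \<in> hom (free_Abelian_group (C q)) (free_Abelian_group (C (q + 1)))"
    and "arrow q z x \<mu> \<Longrightarrow> f (q + 1) (frag_of z) = 0"
    and "arrow q z x \<mu> \<Longrightarrow> f q (frag_of x) = 0"
    and "arrow q z x \<mu> \<Longrightarrow> \<phi> (q + 1) (frag_of z) = 0"
    and "arrow q z x \<mu> \<Longrightarrow> \<phi> q (frag_of x) = frag_cmul (\<rho> div \<mu>) (frag_of z)"
    and "x \<in> H q \<Longrightarrow> f q (frag_of x) = frag_of x"
    and "x \<in> H q \<Longrightarrow> g q (frag_of x) = frag_cmul \<rho> (frag_of x)"
    and "x \<in> H q \<Longrightarrow> \<phi> q (frag_of x) = 0"
proof -
  have *: "f (q + 1) (frag_of z) = 0 \<and> f q (frag_of x) = 0 \<and>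
        \<phi> (q + 1) (frag_of z) = 0 \<and> \<phi> q (frag_of x) = frag_cmul (\<rho> div \<mu>) (frag_of z)"
    if "arrow q z x \<mu>"
  proof -
    have "z \<in> C (q + 1)" "x \<in> C (q + 1 - 1)" "\<mu> > 0"
      "d (q + 1) (frag_of z) = frag_cmul \<mu> (frag_of x)"
      using that by (auto simp: arrow_def)
    moreover have "\<forall>q. \<forall>x \<in> C q. \<forall>y \<in> C (q - 1). \<forall>\<mu>>0. d q (frag_of x) = frag_cmul \<mu> (frag_of y) \<longrightarrow>
        f q (frag_of x) = 0 \<and> f (q - 1) (frag_of y) = 0 \<and>
        \<phi> q (frag_of x) = 0 \<and> \<phi> (q - 1) (frag_of y) = frag_cmul (\<rho> div \<mu>) (frag_of x)"
      using assms by (simp add: prescribed_maps_def)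
    \<comment> \<open>The degree \<open>q + 1 - 1\<close> is kept unsimplified so that the instance
      matches literally.\<close>
    ultimately have "f (q + 1) (frag_of z) = 0 \<and> f (q + 1 - 1) (frag_of x) = 0 \<and>
        \<phi> (q + 1) (frag_of z) = 0 \<and> \<phi> (q + 1 - 1) (frag_of x) = frag_cmul (\<rho> div \<mu>) (frag_of z)"
      by blast
    then show ?thesis
      by simp
  qed
  show "f q \<in> hom (free_Abelian_group (C q)) (free_Abelian_group (H q))"
    "g q \<in> hom (free_Abelian_group (H q)) (free_Abelian_group (C q))"
    "\<phi> q \<in> hom (free_Abelian_group (C q)) (free_Abelian_group (C (q + 1)))"
    using assms by (simp_all add: prescribed_maps_def)
  show "x \<in> H q \<Longrightarrow> f q (frag_of x) = frag_of x"
    "x \<in> H q \<Longrightarrow> g q (frag_of x) = frag_cmul \<rho> (frag_of x)"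
    "x \<in> H q \<Longrightarrow> \<phi> q (frag_of x) = 0"
    using assms by (simp_all add: prescribed_maps_def)
  show "arrow q z x \<mu> \<Longrightarrow> f (q + 1) (frag_of z) = 0"
    "arrow q z x \<mu> \<Longrightarrow> f q (frag_of x) = 0"
    "arrow q z x \<mu> \<Longrightarrow> \<phi> (q + 1) (frag_of z) = 0"
    "arrow q z x \<mu> \<Longrightarrow> \<phi> q (frag_of x) = frag_cmul (\<rho> div \<mu>) (frag_of z)"
    using * by blast+
qed

text \<open>The prescriptions extend linearly once they are consistent: a generator is the target of
  at most one arrow, never both source and target, and members of \<open>H\<close> are
  neither.\<close>

lemma prescribed_maps_exist: "\<exists>f g \<phi>. prescribed_maps C d H \<rho> f g \<phi>"
proof -
  define F where "F q x = (if x \<in> H q then frag_of x else 0)" for q and x :: 'a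
  \<comment> \<open>The choice is harmless, since the arrow into \<open>x\<close> is unique;
    generators that are no targets are sent to zero.\<close>
  define \<Phi> where "\<Phi> q x = (if \<exists>z \<mu>. arrow q z x \<mu>
      then case SOME (z, \<mu>). arrow q z x \<mu> of (z, \<mu>) \<Rightarrow> frag_cmul (\<rho> div \<mu>) (frag_of z) else 0)"
    for q x
  have \<Phi>: "\<Phi> q x = frag_cmul (\<rho> div \<mu>) (frag_of z)" if "arrow q z x \<mu>" for q z x \<mu>
  proof -
    have "(SOME (z, \<mu>). arrow q z x \<mu>) = (z, \<mu>)"
      by (rule some_equality) (use that in \<open>auto dest: arrow_source_unique[OF that] split: prod.splits\<close>)
    then show ?thesis
      using that by (auto simp: \<Phi>_def)
  qed
  have "frag_extend (F q) \<in> hom (free_Abelian_group (C q)) (free_Abelian_group (H q))" for q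
    by (rule frag_extend_in_hom) (simp add: F_def)
  moreover have "frag_extend (\<lambda>x. frag_cmul \<rho> (frag_of x)) \<in>
      hom (free_Abelian_group (H q)) (free_Abelian_group (C q))" for q
    by (rule frag_extend_in_hom) (auto simp: homology_basis_def)
  moreover have "frag_extend (\<Phi> q) \<in> hom (free_Abelian_group (C q)) (free_Abelian_group (C (q + 1)))" for q
  proof (rule frag_extend_in_hom)
    fix x
    show "Poly_Mapping.keys (\<Phi> q x) \<subseteq> C (q + 1)"
    proof (cases "\<exists>z \<mu>. arrow q z x \<mu>")
      case True
      then obtain z \<mu> where "arrow q z x \<mu>"
        by blast
      then show ?thesis
        by (auto simp: \<Phi> arrow_def)
    qed (simp add: \<Phi>_def)
  qed
  moreover have "F q x = 0 \<and> F (q - 1) y = 0 \<and> \<Phi> q x = 0 \<and>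
      \<Phi> (q - 1) y = frag_cmul (\<rho> div \<mu>) (frag_of x)"
    if "x \<in> C q" "y \<in> C (q - 1)" "\<mu> > 0" "d q (frag_of x) = frag_cmul \<mu> (frag_of y)" for q x y \<mu>
  proof -
    have a: "arrow (q - 1) x y \<mu>"
      using that by (simp add: arrow_def)
    \<comment> \<open>A non-zero boundary shows that the source \<open>x\<close> is neither in
      \<open>H\<close> nor a target, so the default value zero applies to it.\<close>
    have "d q (frag_of x) \<noteq> 0"
      using that by simp
    then have "x \<notin> H q" "\<nexists>z \<mu>. arrow q z x \<mu>"
      using d_target by (auto simp: homology_basis_iff)
    then show ?thesis
      using a \<Phi>[OF a] by (auto simp: F_def \<Phi>_def homology_basis_iff)
  qed
  moreover have "F q x = frag_of x \<and> \<Phi> q x = 0" if "x \<in> H q" for q x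
    using that by (auto simp: F_def \<Phi>_def homology_basis_iff)
  ultimately have "prescribed_maps C d H \<rho> (\<lambda>q. frag_extend (F q))
      (\<lambda>q. frag_extend (\<lambda>x. frag_cmul \<rho> (frag_of x))) (\<lambda>q. frag_extend (\<Phi> q))"
    unfolding prescribed_maps_def frag_extend_of by blast
  then show ?thesis
    by blast
qed

text \<open>All identities respect differences in the chain, so they are checked on generators. The
  support facts collected first keep every intermediate chain in the carrier where the next map is
  additive.\<close>

lemma prescribed_maps_AT_model:
  assumes maps: "prescribed_maps C d H \<rho> f g \<phi>"
  shows "lambda_AT_model C d H f g \<phi> \<rho>"
proof -
  note hom_f = prescribed_mapsD(1)[OF maps] and hom_g = prescribed_mapsD(2)[OF maps]
    and hom_\<phi> = prescribed_mapsD(3)[OF maps]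
  have H_C: "H q \<subseteq> C q" for q
    by (auto simp: homology_basis_def)
  have zero: "f q 0 = 0" "g q 0 = 0" "\<phi> q 0 = 0" "d q 0 = 0" for q
    using hom_frag_zero hom_f hom_g hom_\<phi> d_hom by blast+
  have d_keys: "Poly_Mapping.keys (d q c) \<subseteq> C (q - 1)" if "Poly_Mapping.keys c \<subseteq> C q" for q c
    using hom_in_carrier[OF d_hom] that by simp
  have f_keys: "Poly_Mapping.keys (f q c) \<subseteq> H q" if "Poly_Mapping.keys c \<subseteq> C q" for q c
    using hom_in_carrier[OF hom_f] that by simp
  have g_keys: "Poly_Mapping.keys (g q c) \<subseteq> C q" if "Poly_Mapping.keys c \<subseteq> H q" for q c
    using hom_in_carrier[OF hom_g] that by simp
  have \<phi>_keys: "Poly_Mapping.keys (\<phi> q c) \<subseteq> C (q + 1)" if "Poly_Mapping.keys c \<subseteq> C q" for q c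
    using hom_in_carrier[OF hom_\<phi>] that by simp
  have "finite_chain_complex H (\<lambda>q c. 0)"
  proof -
    obtain n where "\<forall>q. q < 0 \<or> q > n \<longrightarrow> C q = {}"
      using complex by (auto simp: finite_chain_complex_def)
    then have "\<forall>q. q < 0 \<or> q > n \<longrightarrow> H q = {}"
      by (auto simp: homology_basis_def)
    then have "\<exists>n. \<forall>q. q < 0 \<or> q > n \<longrightarrow> H q = {}"
      by (rule exI)
    moreover have "(\<lambda>c. 0) \<in> hom (free_Abelian_group (H q)) (free_Abelian_group (H (q - 1)))" for q
      by (rule homI) auto
    moreover have "finite (H q)" for q
      using finite_basis H_C by (rule rev_finite_subset)
    ultimately show ?thesis
      by (simp add: finite_chain_complex_def)
  qed
  moreover have "f (q - 1) (d q c) = 0" if "Poly_Mapping.keys c \<subseteq> C q" for q c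
    using that
  proof (induction c rule: free_Abelian_group_induct[consumes 1, case_names zero diff generator])
    case (generator x)
    then show ?case
    proof (cases rule: generator_cases)
      case (1 y \<mu>)
      then have "f (q - 1) (d q (frag_of x)) = frag_cmul \<mu> (f (q - 1) (frag_of y))"
        using hom_frag_cmul[OF hom_f, of "frag_of y" "q - 1" \<mu>] by (simp add: arrow_def)
      then show ?thesis
        using prescribed_mapsD(5)[OF maps 1] by simp
    next
      case (2 z \<mu>)
      then show ?thesis
        by (simp add: d_target zero)
    next
      case 3
      then show ?thesis
        by (simp add: homology_basis_iff zero)
    qed
  qed (simp_all add: zero hom_frag_diff[OF d_hom] hom_frag_diff[OF hom_f] d_keys)
  moreover have "d q (g q c) = 0" if "Poly_Mapping.keys c \<subseteq> H q" for q c
    using that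
  proof (induction c rule: free_Abelian_group_induct[consumes 1, case_names zero diff generator])
    case (generator x)
    then have "x \<in> C q" "d q (frag_of x) = 0"
      by (auto simp: homology_basis_def)
    then show ?case
      using prescribed_mapsD(9)[OF maps generator] hom_frag_cmul[OF d_hom, of "frag_of x" q \<rho>] by simp
  qed (simp_all add: zero hom_frag_diff[OF d_hom] hom_frag_diff[OF hom_g] g_keys)
  moreover have "f q (g q c) = frag_cmul \<rho> c" if "Poly_Mapping.keys c \<subseteq> H q" for q c
    using that
  proof (induction c rule: free_Abelian_group_induct[consumes 1, case_names zero diff generator])
    case (generator x)
    then have "x \<in> C q"
      by (auto simp: homology_basis_def)
    then show ?case
      using prescribed_mapsD(8)[OF maps generator] prescribed_mapsD(9)[OF maps generator]
        hom_frag_cmul[OF hom_f, of "frag_of x" q \<rho>] by simp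
  next
    case (diff x y)
    then show ?case
      by (simp add: hom_frag_diff[OF hom_f] hom_frag_diff[OF hom_g] g_keys frag_cmul_diff_distrib2)
  qed (simp add: zero)
  moreover have "frag_cmul \<rho> c - g q (f q c) = \<phi> (q - 1) (d q c) + d (q + 1) (\<phi> q c)"
    if "Poly_Mapping.keys c \<subseteq> C q" for q c
    using that
  proof (induction c rule: free_Abelian_group_induct[consumes 1, case_names zero diff generator])
    case (generator x)
    then show ?case
    proof (cases rule: generator_cases)
      case (1 y \<mu>)
      \<comment> \<open>For a source only the summand \<phi> d survives; it gives \<mu> times
        \<rho>/\<mu>, and the division is exact because \<mu> divides \<rho>.\<close>
      have "f q (frag_of x) = 0" "\<phi> q (frag_of x) = 0"
        using prescribed_mapsD(4,6)[OF maps 1] by simp_all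
      moreover have "\<phi> (q - 1) (d q (frag_of x)) = frag_cmul \<mu> (\<phi> (q - 1) (frag_of y))"
        using hom_frag_cmul[OF hom_\<phi>, of "frag_of y" "q - 1" \<mu>] 1 by (simp add: arrow_def)
      ultimately show ?thesis
        using prescribed_mapsD(7)[OF maps 1] arrow_dvd_entries_lcm[OF 1] by (simp add: zero)
    next
      case (2 z \<mu>)
      \<comment> \<open>For a target only the summand d \<phi> survives, with the same two factors
        in the other order.\<close>
      have "d (q + 1) (frag_cmul (\<rho> div \<mu>) (frag_of z)) = frag_cmul (\<rho> div \<mu> * \<mu>) (frag_of x)"
        using hom_frag_cmul[OF d_hom, of "frag_of z" "q + 1"] 2 by (simp add: arrow_def)
      then show ?thesis
        using prescribed_mapsD(5,7)[OF maps 2] arrow_dvd_entries_lcm[OF 2]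
        by (simp add: zero d_target[OF 2])
    next
      case 3
      \<comment> \<open>On \<open>H\<close> both homotopy terms vanish, and the composite of
        \<open>f\<close> and \<open>g\<close> is already multiplication by \<rho>.\<close>
      then show ?thesis
        using prescribed_mapsD(8-10)[OF maps 3] by (simp add: zero homology_basis_iff)
    qed
  next
    case (diff x y)
    have "frag_cmul \<rho> (x - y) = frag_cmul \<rho> x - frag_cmul \<rho> y"
      by (simp add: frag_cmul_diff_distrib2)
    moreover have "g q (f q (x - y)) = g q (f q x) - g q (f q y)"
      using diff by (simp add: hom_frag_diff[OF hom_f] hom_frag_diff[OF hom_g] f_keys)
    moreover have "\<phi> (q - 1) (d q (x - y)) = \<phi> (q - 1) (d q x) - \<phi> (q - 1) (d q y)"
      using diff by (simp add: hom_frag_diff[OF d_hom] hom_frag_diff[OF hom_\<phi>] d_keys)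
    moreover have "d (q + 1) (\<phi> q (x - y)) = d (q + 1) (\<phi> q x) - d (q + 1) (\<phi> q y)"
      using diff by (simp add: hom_frag_diff[OF hom_\<phi>] hom_frag_diff[OF d_hom] \<phi>_keys)
    moreover have "frag_cmul \<rho> (x - y) - g q (f q (x - y)) =
        (frag_cmul \<rho> x - g q (f q x)) - (frag_cmul \<rho> y - g q (f q y))"
      using calculation by simp
    ultimately show ?case
      by (simp add: diff.IH)
  qed (simp add: zero)
  ultimately show ?thesis
    using complex entries_lcm_pos hom_f hom_g hom_\<phi>
    by (simp add: lambda_AT_model_def lambda_chain_contraction_def zero)
qed

end

context smith_complex begin

subsection \<open>The torsion of homology\<close>

definition target :: "int \<Rightarrow> 'a set" where
  "target q = {x. \<exists>z \<mu>. arrow q z x \<mu>}"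

text \<open>The weight is unique for every target. It is a natural number because it will be the
  order of a cyclic group.\<close>

definition weight :: "int \<Rightarrow> 'a \<Rightarrow> nat" where
  "weight q x = nat (THE \<mu>. \<exists>z. arrow q z x \<mu>)"

lemma target_subset: "target q \<subseteq> C q"
  by (auto simp: target_def arrow_def)

lemma weight_arrow:
  assumes "arrow q z x \<mu>"
  shows "int (weight q x) = \<mu>"
proof -
  have "(THE \<mu>. \<exists>z. arrow q z x \<mu>) = \<mu>"
    using assms arrow_source_unique(2) by blast
  then show ?thesis
    using assms by (simp add: weight_def arrow_def)
qed

lemma target_arrow: "x \<in> target q \<Longrightarrow> \<exists>z. arrow q z x (int (weight q x))"
  using weight_arrow by (fastforce simp: target_def)

text \<open>The boundary of a generator is zero or a target times its weight. Conversely, dividing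
  each coefficient by its weight and lifting along the arrow gives a preimage.\<close>

lemma boundaries_eq:
  "d (q + 1) ` carrier (free_Abelian_group (C (q + 1))) =
     diagonal_sublattice (target q) (weight q)" (is "?L = ?R")
proof (intro equalityI subsetI)
  fix b assume "b \<in> ?L"
  then obtain c where c: "Poly_Mapping.keys c \<subseteq> C (q + 1)" "b = d (q + 1) c"
    by auto
  have "d (q + 1) c \<in> ?R"
    using c(1)
  proof (induction c rule: free_Abelian_group_induct[consumes 1, case_names zero diff generator])
    case zero
    then show ?case
      by (simp add: hom_frag_zero[OF d_hom] diagonal_sublattice_def)
  next
    case (diff x y)
    then show ?case
      using keys_diff[of "d (q + 1) x" "d (q + 1) y"]
      by (auto simp: hom_frag_diff[OF d_hom] diagonal_sublattice_def lookup_minus)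
  next
    case (generator z)
    then show ?case
    proof (cases rule: d_generator_cases)
      case 1
      then show ?thesis
        by (simp add: diagonal_sublattice_def)
    next
      case (2 x \<mu>)
      then have a: "arrow q z x \<mu>"
        by simp
      then have "d (q + 1) (frag_of z) = frag_cmul (int (weight q x)) (frag_of x)"
        using weight_arrow[OF a] by (simp add: arrow_def)
      moreover have "x \<in> target q"
        using a by (auto simp: target_def)
      ultimately show ?thesis
        by (auto simp: diagonal_sublattice_def)
    qed
  qed
  then show "b \<in> ?R"
    using c(2) by simp
next
  fix b assume b: "b \<in> ?R"
  have "\<forall>x\<in>target q. \<exists>z. arrow q z x (int (weight q x))"
    using target_arrow by blast
  from bchoice[OF this] obtain s
    where s: "\<And>x. x \<in> target q \<Longrightarrow> arrow q (s x) x (int (weight q x))"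
    by blast
  have b_target: "x \<in> target q" if "x \<in> Poly_Mapping.keys b" for x
    using b that by (auto simp: diagonal_sublattice_def)
  \<comment> \<open>The preimage of \<open>b\<close>: each target is replaced by the source
    \<open>s x\<close> of its arrow.\<close>
  define a where "a = (\<Sum>x\<in>Poly_Mapping.keys b.
    frag_cmul (Poly_Mapping.lookup b x div int (weight q x)) (frag_of (s x)))"
  have a_carrier: "a \<in> carrier (free_Abelian_group (C (q + 1)))"
    unfolding a_def
    by (rule sum_closed_free_Abelian_group) (use s b_target in \<open>auto simp: arrow_def\<close>)
  then have "d (q + 1) a = frag_extend (\<lambda>z. d (q + 1) (frag_of z)) a"
    using hom_eq_frag_extend[OF d_hom] by simp
  also have "\<dots> = (\<Sum>x\<in>Poly_Mapping.keys b.
    frag_cmul (Poly_Mapping.lookup b x div int (weight q x)) (d (q + 1) (frag_of (s x))))"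
    by (simp add: a_def frag_extend_sum frag_extend_cmul)
  also have "\<dots> = (\<Sum>x\<in>Poly_Mapping.keys b. frag_cmul (Poly_Mapping.lookup b x) (frag_of x))"
  proof (rule sum.cong)
    fix x assume x: "x \<in> Poly_Mapping.keys b"
    then have "int (weight q x) dvd Poly_Mapping.lookup b x"
      using b b_target by (auto simp: diagonal_sublattice_def)
    then show "frag_cmul (Poly_Mapping.lookup b x div int (weight q x)) (d (q + 1) (frag_of (s x))) =
        frag_cmul (Poly_Mapping.lookup b x) (frag_of x)"
      using s[OF b_target[OF x]] by (simp add: arrow_def)
  qed simp
  also have "\<dots> = b"
    using frag_expansion[of b] by (simp add: frag_extend_def)
  finally show "b \<in> ?L"
    using a_carrier by blast
qed

lemma weight_dvd_entries_lcm: "x \<in> target q \<Longrightarrow> int (weight q x) dvd \<rho>"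
  using target_arrow arrow_dvd_entries_lcm by blast

lemma entries_lcm_multiple_in_diagonal:
  assumes "Poly_Mapping.keys c \<subseteq> target q"
  shows "frag_cmul \<rho> c \<in> diagonal_sublattice (target q) (weight q)"
  using assms weight_dvd_entries_lcm by (auto simp: diagonal_sublattice_def)

text \<open>A positive multiple of a chain has the same support as the chain, so a cycle that is
  torsion modulo boundaries involves targets only. Conversely every chain of targets is a cycle, and
  \<rho> times it is a boundary.\<close>

lemma torsion_homology:
  "torsion_subgroup (homology C d q) =
     free_Abelian_group (target q) Mod diagonal_sublattice (target q) (weight q)"
proof -
  let ?F = "free_Abelian_group (C q)" and ?B = "diagonal_sublattice (target q) (weight q)"
  let ?K = "kernel ?F (free_Abelian_group (C (q - 1))) (d q)"
  interpret comm_group ?F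
    by (rule abelian_free_Abelian_group)
  interpret d: group_hom ?F "free_Abelian_group (C (q - 1))" "d q"
    using d_hom by (simp add: group_hom_def group_hom_axioms_def)
  have cycle: "c \<in> ?K" if "Poly_Mapping.keys c \<subseteq> target q" for c
  proof -
    have keys: "Poly_Mapping.keys c \<subseteq> C q"
      using that target_subset by blast
    have "d q c = 0"
      unfolding hom_eq_frag_extend[OF d_hom keys]
      by (rule frag_extend_eq_0) (use that d_target in \<open>auto simp: target_def\<close>)
    then show ?thesis
      using keys by (simp add: kernel_def)
  qed
  have normal: "?B \<lhd> ?F\<lparr>carrier := ?K\<rparr>"
  proof (rule normal_restrict_supergroup)
    show "?B \<lhd> ?F"
      by (intro subgroup_imp_normal diagonal_sublattice_subgroup target_subset)
    show "?B \<subseteq> ?K"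
      using cycle by (auto simp: diagonal_sublattice_def)
  qed (rule d.subgroup_kernel)
  have "{c \<in> ?K. \<exists>n::nat. n > 0 \<and> frag_cmul (int n) c \<in> ?B} = carrier (free_Abelian_group (target q))"
  proof (intro equalityI subsetI)
    fix c assume "c \<in> {c \<in> ?K. \<exists>n::nat. n > 0 \<and> frag_cmul (int n) c \<in> ?B}"
    then show "c \<in> carrier (free_Abelian_group (target q))"
      by (auto simp: diagonal_sublattice_def)
  next
    fix c assume "c \<in> carrier (free_Abelian_group (target q))"
    then have c: "Poly_Mapping.keys c \<subseteq> target q"
      by simp
    \<comment> \<open>One exponent, \<rho>, serves all chains of targets at once.\<close>
    then have "nat \<rho> > 0 \<and> frag_cmul (int (nat \<rho>)) c \<in> ?B"
      using entries_lcm_pos entries_lcm_multiple_in_diagonal by simp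
    then show "c \<in> {c \<in> ?K. \<exists>n::nat. n > 0 \<and> frag_cmul (int n) c \<in> ?B}"
      using cycle[OF c] by blast
  qed
  moreover have "c [^]\<^bsub>?F\<lparr>carrier := ?K\<rparr>\<^esub> n = frag_cmul (int n) c" for c and n :: nat
    by (simp flip: nat_pow_consistent)
  moreover have "homology C d q = ?F\<lparr>carrier := ?K\<rparr> Mod ?B"
    by (simp add: homology_def boundaries_eq)
  moreover have "?F\<lparr>carrier := carrier (free_Abelian_group (target q))\<rparr> = free_Abelian_group (target q)"
    by (simp add: free_Abelian_group_def)
  ultimately show ?thesis
    by (simp add: torsion_subgroup_Mod[OF normal])
qed

section \<open>Primes of the torsion\<close>

text \<open>A prime dividing \<rho> divides the weight of some arrow and thus appears in the primary
  decomposition. Conversely \<rho> annihilates the torsion, so every invariant factor divides it,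
  whichever decomposition it is taken from.\<close>

lemma prime_dvd_entries_lcm_iff:
  fixes p :: nat
  assumes "prime p"
  shows "int p dvd \<rho> \<longleftrightarrow> (\<exists>q m k. invariant_factor (homology C d q) m \<and> m = p ^ k)"
proof
  assume "int p dvd \<rho>"
  then obtain q z x \<mu> where a: "arrow q z x \<mu>" "int p dvd \<mu>"
    using assms by (elim prime_dvd_entries_lcmE[rotated]) auto
  have x: "x \<in> target q" "p dvd weight q x"
    using a weight_arrow[OF a(1)] by (auto simp: target_def simp flip: int_dvd_int_iff)
  have "finite (target q)"
    using finite_basis target_subset by (rule rev_finite_subset)
  moreover have "weight q y > 0" if "y \<in> target q" for y
    using target_arrow[OF that] by (auto simp: arrow_def)
  ultimately obtain ms where ms: "\<And>k. k \<in> set ms \<Longrightarrow> primepow k"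
      "\<And>y p. y \<in> target q \<Longrightarrow> prime p \<Longrightarrow> p dvd weight q y \<Longrightarrow> \<exists>k. p ^ k \<in> set ms"
      "torsion_subgroup (homology C d q) \<cong>
         sum_group {..<length ms} (\<lambda>i. integer_mod_group (ms ! i))"
    using free_Abelian_group_Mod_diagonal[of "target q" "weight q"] unfolding torsion_homology
    by metis
  then obtain k where "p ^ k \<in> set ms"
    using x assms by blast
  then have "invariant_factor (homology C d q) (p ^ k)"
    using ms unfolding invariant_factor_def by blast
  then show "\<exists>q m k. invariant_factor (homology C d q) m \<and> m = p ^ k"
    by blast
next
  assume "\<exists>q m k. invariant_factor (homology C d q) m \<and> m = p ^ k"
  then obtain q k where "invariant_factor (homology C d q) (p ^ k)"
    by blast
  then obtain ms where ms: "p ^ k \<in> set ms" "\<forall>m\<in>set ms. primepow m"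
      and iso: "torsion_subgroup (homology C d q) \<cong>
        sum_group {..<length ms} (\<lambda>i. integer_mod_group (ms ! i))"
    unfolding invariant_factor_def by blast
  \<comment> \<open>Being a prime power excludes \<open>k = 0\<close>; otherwise 1 would count as a
    power of every prime.\<close>
  have "primepow (p ^ k)"
    using ms by blast
  then have "k > 0" "p ^ k \<noteq> 1"
    by (auto intro: gr0I)
  let ?T = "free_Abelian_group (target q)" and ?B = "diagonal_sublattice (target q) (weight q)"
  interpret normal ?B ?T
    by (rule diagonal_sublattice_normal)
  have "X [^]\<^bsub>?T Mod ?B\<^esub> nat \<rho> = \<one>\<^bsub>?T Mod ?B\<^esub>" if X: "X \<in> carrier (?T Mod ?B)" for X
  proof -
    obtain c where c: "c \<in> carrier ?T" "X = ?B #>\<^bsub>?T\<^esub> c"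
      using X by (auto simp: carrier_FactGroup)
    then have "X [^]\<^bsub>?T Mod ?B\<^esub> nat \<rho> = ?B #>\<^bsub>?T\<^esub> frag_cmul \<rho> c"
      using FactGroup_pow[of c "nat \<rho>"] entries_lcm_pos by simp
    also have "\<dots> = ?B"
      using c entries_lcm_multiple_in_diagonal by (intro rcos_const) auto
    finally show ?thesis
      by simp
  qed
  then have "p ^ k dvd nat \<rho>"
    using dvd_exponent_sum_group[OF factorgroup_is_group _ _ ms(1) \<open>p ^ k \<noteq> 1\<close>] iso
    unfolding torsion_homology by blast
  then have "p dvd nat \<rho>"
    using \<open>k > 0\<close> dvd_power dvd_trans by blast
  then show "int p dvd \<rho>"
    using entries_lcm_pos by (simp add: int_dvd_int_iff[symmetric])
qed

end

text \<open>Existence is a separate clause so that the universal one is not vacuous. The latter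
  ranges over all prescribed families, which may differ off the carriers.\<close>

theorem proposition4p8:
  fixes C :: "int \<Rightarrow> 'a set"
    and d :: "int \<Rightarrow> ('a \<Rightarrow>\<^sub>0 int) \<Rightarrow> ('a \<Rightarrow>\<^sub>0 int)"
    and \<rho> :: int
    and H :: "int \<Rightarrow> 'a set"
  assumes complex: "finite_chain_complex C d"
    and snf: "\<And>q. smith_normal_form (C (q - 1)) (C q) (matrix_entry d q)"
    and rho: "\<rho> = entries_lcm C d"
    and H: "H = homology_basis C d"
  shows "(\<exists>f g \<phi>. prescribed_maps C d H \<rho> f g \<phi>) \<and>
         (\<forall>f g \<phi>. prescribed_maps C d H \<rho> f g \<phi> \<longrightarrow> lambda_AT_model C d H f g \<phi> \<rho>) \<and>
         (\<forall>p::nat. prime p \<longrightarrow>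
            (int p dvd \<rho> \<longleftrightarrow> (\<exists>q m k. invariant_factor (homology C d q) m \<and> m = p ^ k)))"
proof -
  interpret smith_complex C d
    by (rule smith_complex.intro[OF complex snf])
  show ?thesis
    unfolding rho H
    using prescribed_maps_exist prescribed_maps_AT_model prime_dvd_entries_lcm_iff by blast
qed

end
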